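(* For any total computable function $f:\mathbb{N}\to\mathbb{N}$ there is a computable ${\bf x}_0\in 2^{\mathbb{Z}}$ such that the sequence $m_i({\bf x}_0)$, $i\in\mathbb{N}$, converges to $0$, but for every positive integer $k$ there is $j>f(k)$ such that $|m_j({\bf x}_0)|\ge\frac1k$.
   Context: $2^{\mathbb{Z}}$ is the set of functions $\mathbb{Z}\to\{0,1\}$; such a function is computable if it is computable with respect to a standard one-to-one computable enumeration of $\mathbb{Z}$. The standard F\o lner sequence of $(\mathbb{Z},+)$ is $\mathcal{F}=(\{-i,-i+1,\ldots,0,\ldots,i-1,i\} \mid i\in\mathbb{N})$, and the corresponding means are $m_i({\bf x})=\frac{1}{2i+1}\sum_{h=-i}^{i}{\bf x}(h)$. *)

theory Defs
  imports Complex_Main "HOL-Library.Nat_Bijection"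
begin

text \<open>
  Kleene's partial recursive functions: programs and their big-step evaluation. The relation
  \<open>evaluates p xs y\<close> says that \<open>p\<close> halts on the arguments \<open>xs\<close> with result \<open>y\<close>;
  divergence is represented by the absence of a result.
\<close>

datatype recf =
    Zero
  | Succ
  | Proj nat
  | Comp recf "recf list"
  | PrimRec recf recf
  | Mu recf

inductive evaluates :: "recf \<Rightarrow> nat list \<Rightarrow> nat \<Rightarrow> bool" where
  Zero: "evaluates Zero xs 0"
| Succ: "evaluates Succ [n] (Suc n)"
| Proj: "i < length xs \<Longrightarrow> evaluates (Proj i) xs (xs ! i)"
| Comp: "list_all2 (\<lambda>q y. evaluates q xs y) qs ys \<Longrightarrow> evaluates p ys z
    \<Longrightarrow> evaluates (Comp p qs) xs z"
| PrimRec_0: "evaluates p xs y \<Longrightarrow> evaluates (PrimRec p q) (0 # xs) y"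
| PrimRec_Suc: "evaluates (PrimRec p q) (n # xs) y \<Longrightarrow> evaluates q (n # y # xs) z
    \<Longrightarrow> evaluates (PrimRec p q) (Suc n # xs) z"
| Mu: "evaluates p (n # xs) 0 \<Longrightarrow> (\<And>m. m < n \<Longrightarrow> \<exists>y>0. evaluates p (m # xs) y)
    \<Longrightarrow> evaluates (Mu p) xs n"

inductive_cases evaluates_ZeroE: "evaluates Zero xs y"
inductive_cases evaluates_SuccE: "evaluates Succ xs y"
inductive_cases evaluates_ProjE: "evaluates (Proj i) xs y"
inductive_cases evaluates_CompE: "evaluates (Comp p qs) xs y"
inductive_cases evaluates_PrimRec_0E: "evaluates (PrimRec p q) (0 # xs) y"
inductive_cases evaluates_PrimRec_SucE: "evaluates (PrimRec p q) (Suc n # xs) y"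
inductive_cases evaluates_MuE: "evaluates (Mu p) xs y"

lemma evaluates_deterministic:
  "evaluates p xs y \<Longrightarrow> evaluates p xs z \<Longrightarrow> y = z"
proof (induction p xs y arbitrary: z rule: evaluates.induct)
  case (Zero xs)
  then show ?case by (blast elim: evaluates_ZeroE)
next
  case (Succ n)
  then show ?case by (blast elim: evaluates_SuccE)
next
  case (Proj i xs)
  then show ?case by (blast elim: evaluates_ProjE)
next
  case (Comp xs qs ys p y)
  from Comp.prems obtain ys' where
    ys': "list_all2 (\<lambda>q y. evaluates q xs y) qs ys'" "evaluates p ys' z"
    by (rule evaluates_CompE)
  have "ys = ys'"
  proof (rule nth_equalityI)
    show "length ys = length ys'"
      using list_all2_lengthD[OF Comp.IH(1)] list_all2_lengthD[OF ys'(1)] by simp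
    fix i assume "i < length ys"
    then have "i < length qs"
      using list_all2_lengthD[OF Comp.IH(1)] by simp
    then show "ys ! i = ys' ! i"
      using list_all2_nthD[OF Comp.IH(1)] list_all2_nthD[OF ys'(1)] by simp
  qed
  with ys'(2) show ?case by (auto intro: Comp.IH(2))
next
  case (PrimRec_0 p xs y q)
  then show ?case by (blast elim: evaluates_PrimRec_0E)
next
  case (PrimRec_Suc p q n xs y w)
  from PrimRec_Suc.prems obtain y' where
    "evaluates (PrimRec p q) (n # xs) y'" "evaluates q (n # y' # xs) z"
    by (rule evaluates_PrimRec_SucE)
  with PrimRec_Suc.IH(1)[OF this(1)] show ?case by (auto intro: PrimRec_Suc.IH(2))
next
  case (Mu p n xs)
  from Mu.prems have z: "evaluates p (z # xs) 0"
    by (rule evaluates_MuE)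
  from Mu.prems have less_z: "\<exists>y>0. evaluates p (m # xs) y" if "m < z" for m
    by (rule evaluates_MuE) (use that in blast)
  show ?case
  proof (cases n z rule: linorder_cases)
    case less
    then obtain y where "y > 0" "evaluates p (n # xs) y" using less_z by blast
    with Mu.IH(1)[OF this(2)] show ?thesis by simp
  next
    case greater
    then obtain y where "y > 0" "\<forall>w. evaluates p (z # xs) w \<longrightarrow> y = w" using Mu.IH(2) by blast
    with z show ?thesis by auto
  qed
qed

definition computable :: "(nat \<Rightarrow> nat) \<Rightarrow> bool" where
  "computable f \<longleftrightarrow> (\<exists>p. \<forall>n. evaluates p [n] (f n))"

text \<open>
  Functions on \<open>\<int>\<close> are transported along the enumeration \<open>int_decode\<close>: \<open>0, -1, 1, -2, 2, \<dots>\<close>.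
\<close>

definition computable_int :: "(int \<Rightarrow> nat) \<Rightarrow> bool" where
  "computable_int x \<longleftrightarrow> computable (\<lambda>n. x (int_decode n))"

definition folner_mean :: "nat \<Rightarrow> (int \<Rightarrow> nat) \<Rightarrow> real" where
  "folner_mean i x = 1 / (2 * real i + 1) * (\<Sum>h = - int i..int i. real (x h))"

end

theory Submission
  imports Defs
begin

text \<open>
  Along the enumeration \<open>0, -1, 1, -2, 2, \<dots>\<close> of \<open>\<int>\<close> the Folner set \<open>{-j..j}\<close> is an initial
  segment of length \<open>2 * j + 1\<close>, so the means of a configuration are averages of a \<open>0\<close>-\<open>1\<close> sequence
  over initial segments of odd length. It therefore suffices to build a computable \<open>0\<close>-\<open>1\<close> sequence
  whose averages tend to \<open>0\<close>, but so slowly that for every \<open>k > 0\<close> the average of the first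
  \<open>2 * (f k + 1) + 1\<close> terms is still at least \<open>1 / k\<close>.

  Such a sequence is produced greedily. Let \<open>level n\<close> be a computable, nondecreasing, unbounded
  function that is at most \<open>k\<close> at \<open>2 * (f k + 1) + 1\<close> for \<open>k > 0\<close>; it is the generalised inverse of a
  fast-growing function obtained from \<open>f\<close>. The sequence puts a \<open>1\<close> at position \<open>n\<close> exactly when
  otherwise the first \<open>n + 1\<close> terms would have an average below \<open>1 / level (n + 1)\<close>. Since the level
  never decreases, one new \<open>1\<close> always suffices, and so the average of the first \<open>n\<close> terms is at least
  \<open>1 / level n\<close> for all \<open>n > 0\<close> (\<open>ones_ge\<close>). Once the level exceeds \<open>K\<close>, a \<open>1\<close> is only placed while the
  average is at most \<open>1 / K\<close>, so the averages are eventually close to \<open>1 / K\<close> or less (\<open>ones_le\<close>);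
  as the level is unbounded, they tend to \<open>0\<close>.

  Computability follows from closure properties of the functions computed by total programs: the
  fast-growing function and the number of ones placed so far are primitive recursive in computable
  functions, and the level is an unbounded search that always succeeds.
\<close>

section \<open>Functions computed by total programs\<close>

text \<open>
  Arguments are kept as a list, as in the evaluation relation, so that one set of closure rules serves
  all arities. Only lists of length \<open>a\<close> count: on other lists \<open>p\<close> may diverge and \<open>h\<close> may involve
  unspecified values of \<open>xs ! i\<close>.
\<close>

definition total_rec :: "nat \<Rightarrow> (nat list \<Rightarrow> nat) \<Rightarrow> bool" where
  "total_rec a h \<longleftrightarrow> (\<exists>p. \<forall>xs. length xs = a \<longrightarrow> evaluates p xs (h xs))"

lemma computable_iff_total_rec: "computable f \<longleftrightarrow> total_rec 1 (\<lambda>xs. f (xs ! 0))"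
proof
  assume "computable f"
  then obtain p where "\<forall>n. evaluates p [n] (f n)" unfolding computable_def by blast
  then show "total_rec 1 (\<lambda>xs. f (xs ! 0))"
    unfolding total_rec_def by (intro exI[of _ p]) (auto simp: length_Suc_conv)
next
  assume "total_rec 1 (\<lambda>xs. f (xs ! 0))"
  then obtain p where "\<And>xs. length xs = 1 \<Longrightarrow> evaluates p xs (f (xs ! 0))"
    unfolding total_rec_def by blast
  from this[of "[_]"] show "computable f" unfolding computable_def by auto
qed

lemma total_rec_cong:
  "(\<And>xs. length xs = a \<Longrightarrow> g xs = h xs) \<Longrightarrow> total_rec a g \<longleftrightarrow> total_rec a h"
  unfolding total_rec_def by simp

lemma total_rec_proj: "i < a \<Longrightarrow> total_rec a (\<lambda>xs. xs ! i)"
  unfolding total_rec_def by (blast intro: evaluates.Proj)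

lemma total_rec_zero: "total_rec a (\<lambda>xs. 0)"
  unfolding total_rec_def by (blast intro: evaluates.Zero)

lemma total_rec_comp1:
  assumes "total_rec 1 (\<lambda>zs. u (zs ! 0))" "total_rec a g"
  shows "total_rec a (\<lambda>xs. u (g xs))"
proof -
  obtain p where p: "\<And>zs. length zs = 1 \<Longrightarrow> evaluates p zs (u (zs ! 0))"
    using assms(1) unfolding total_rec_def by blast
  obtain q where q: "\<And>xs. length xs = a \<Longrightarrow> evaluates q xs (g xs)"
    using assms(2) unfolding total_rec_def by blast
  have "evaluates (Comp p [q]) xs (u (g xs))" if "length xs = a" for xs
    using p[of "[g xs]"] q[OF that] by (intro evaluates.Comp[where ys = "[g xs]"]) auto
  then show ?thesis unfolding total_rec_def by blast
qed

lemma total_rec_comp2: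
  assumes "total_rec 2 (\<lambda>zs. u (zs ! 0) (zs ! 1))" "total_rec a g" "total_rec a h"
  shows "total_rec a (\<lambda>xs. u (g xs) (h xs))"
proof -
  obtain p where p: "\<And>zs. length zs = 2 \<Longrightarrow> evaluates p zs (u (zs ! 0) (zs ! 1))"
    using assms(1) unfolding total_rec_def by blast
  obtain q where q: "\<And>xs. length xs = a \<Longrightarrow> evaluates q xs (g xs)"
    using assms(2) unfolding total_rec_def by blast
  obtain r where r: "\<And>xs. length xs = a \<Longrightarrow> evaluates r xs (h xs)"
    using assms(3) unfolding total_rec_def by blast
  have "evaluates (Comp p [q, r]) xs (u (g xs) (h xs))" if "length xs = a" for xs
    using p[of "[g xs, h xs]"] q[OF that] r[OF that]
    by (intro evaluates.Comp[where ys = "[g xs, h xs]"]) auto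
  then show ?thesis unfolding total_rec_def by blast
qed

lemma total_rec_Suc:
  assumes "total_rec a g"
  shows "total_rec a (\<lambda>xs. Suc (g xs))"
proof -
  have "computable Suc" unfolding computable_def by (blast intro: evaluates.Succ)
  then show ?thesis using assms by (simp add: computable_iff_total_rec total_rec_comp1)
qed

lemma total_rec_primrec:
  assumes base: "total_rec a base" and step: "total_rec (Suc (Suc a)) step"
    and r_0: "\<And>xs. length xs = a \<Longrightarrow> r 0 xs = base xs"
    and r_Suc: "\<And>n xs. length xs = a \<Longrightarrow> r (Suc n) xs = step (n # r n xs # xs)"
  shows "total_rec (Suc a) (\<lambda>zs. r (hd zs) (tl zs))"
proof -
  obtain p where p: "\<And>xs. length xs = a \<Longrightarrow> evaluates p xs (base xs)"
    using base unfolding total_rec_def by blast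
  obtain q where q: "\<And>xs. length xs = Suc (Suc a) \<Longrightarrow> evaluates q xs (step xs)"
    using step unfolding total_rec_def by blast
  have "evaluates (PrimRec p q) (n # xs) (r n xs)" if "length xs = a" for n xs
  proof (induction n)
    case 0
    then show ?case using p[OF that] by (simp add: r_0 that evaluates.PrimRec_0)
  next
    case (Suc n)
    then show ?case using q[of "n # r n xs # xs"] that
      by (simp add: r_Suc evaluates.PrimRec_Suc)
  qed
  then have "evaluates (PrimRec p q) zs (r (hd zs) (tl zs))" if "length zs = Suc a" for zs
    using that by (cases zs) auto
  then show ?thesis unfolding total_rec_def by blast
qed

lemma computable_primrec:
  assumes "total_rec 2 step" "r 0 = 0" "\<And>n. r (Suc n) = step [n, r n]"
  shows "computable r"
proof -
  have "total_rec (Suc 0) (\<lambda>zs. r (hd zs))"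
    using assms by (intro total_rec_primrec[where base = "\<lambda>_. 0" and step = step])
      (auto simp: total_rec_zero numeral_2_eq_2)
  also have "total_rec (Suc 0) (\<lambda>zs. r (hd zs)) \<longleftrightarrow> total_rec 1 (\<lambda>zs. r (zs ! 0))"
    unfolding One_nat_def by (rule total_rec_cong) (auto simp: length_Suc_conv)
  finally show ?thesis by (simp only: computable_iff_total_rec)
qed

lemma total_rec_binary_primrec:
  assumes "total_rec 1 (\<lambda>xs. base (xs ! 0))" "total_rec 3 step"
    and "\<And>y. u 0 y = base y" "\<And>n y. u (Suc n) y = step [n, u n y, y]"
  shows "total_rec 2 (\<lambda>zs. u (zs ! 0) (zs ! 1))"
proof -
  have "total_rec (Suc 1) (\<lambda>zs. u (hd zs) (tl zs ! 0))"
    using assms by (intro total_rec_primrec[where base = "\<lambda>xs. base (xs ! 0)" and step = step])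
      (auto simp: length_Suc_conv numeral_3_eq_3)
  also have "total_rec (Suc 1) (\<lambda>zs. u (hd zs) (tl zs ! 0)) \<longleftrightarrow>
      total_rec 2 (\<lambda>zs. u (zs ! 0) (zs ! 1))"
    unfolding Suc_1 by (rule total_rec_cong) (auto simp: length_Suc_conv numeral_2_eq_2)
  finally show ?thesis .
qed

lemma total_rec_add:
  assumes "total_rec a g" "total_rec a h"
  shows "total_rec a (\<lambda>xs. g xs + h xs)"
proof (rule total_rec_comp2[OF _ assms])
  have "total_rec 3 (\<lambda>zs. Suc (zs ! 1))"
    by (intro total_rec_Suc total_rec_proj) simp
  then show "total_rec 2 (\<lambda>zs. zs ! 0 + zs ! 1)"
    by (intro total_rec_binary_primrec[where base = "\<lambda>y. y" and step = "\<lambda>zs. Suc (zs ! 1)"])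
      (auto intro: total_rec_proj)
qed

lemma total_rec_mult:
  assumes "total_rec a g" "total_rec a h"
  shows "total_rec a (\<lambda>xs. g xs * h xs)"
proof (rule total_rec_comp2[OF _ assms])
  have "total_rec 3 (\<lambda>zs. zs ! 1 + zs ! 2)"
    by (intro total_rec_add total_rec_proj) simp_all
  then show "total_rec 2 (\<lambda>zs. zs ! 0 * zs ! 1)"
    by (intro total_rec_binary_primrec[where base = "\<lambda>y. 0" and step = "\<lambda>zs. zs ! 1 + zs ! 2"])
      (auto intro: total_rec_zero)
qed

text \<open>
  Truncated subtraction is how the programs below decide inequalities: \<open>m \<le> n\<close> iff \<open>m - n = 0\<close>.
\<close>

lemma total_rec_diff:
  assumes "total_rec a g" "total_rec a h"
  shows "total_rec a (\<lambda>xs. g xs - h xs)"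
proof -
  have "computable (\<lambda>n. n - 1)"
    by (rule computable_primrec[where step = "\<lambda>zs. zs ! 0"]) (auto intro: total_rec_proj)
  then have pred: "total_rec 1 (\<lambda>zs. zs ! 0 - 1)"
    by (simp add: computable_iff_total_rec)
  have "total_rec 3 (\<lambda>zs. zs ! 1 - 1)"
    by (rule total_rec_comp1[OF pred]) (auto intro: total_rec_proj)
  \<comment> \<open>the recursion runs on the subtrahend, which therefore has to come first\<close>
  then have "total_rec 2 (\<lambda>zs. zs ! 1 - zs ! 0)"
    by (intro total_rec_binary_primrec[where base = "\<lambda>y. y" and step = "\<lambda>zs. zs ! 1 - 1"
          and u = "\<lambda>m n. n - m"])
      (auto intro: total_rec_proj)
  from total_rec_comp2[where u = "\<lambda>m n. n - m", OF this assms(2,1)] show ?thesis .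
qed

lemma computable_Least:
  assumes g: "total_rec 2 (\<lambda>zs. g (zs ! 0) (zs ! 1))" and ex: "\<And>n. \<exists>k. g k n = 0"
  shows "computable (\<lambda>n. LEAST k. g k n = 0)"
proof -
  obtain p where p: "\<And>zs. length zs = 2 \<Longrightarrow> evaluates p zs (g (zs ! 0) (zs ! 1))"
    using g unfolding total_rec_def by blast
  have g_eval: "evaluates p [k, n] (g k n)" for k n
    using p[of "[k, n]"] by simp
  have "evaluates (Mu p) [n] (LEAST k. g k n = 0)" for n
  proof (rule evaluates.Mu)
    have "g (LEAST k. g k n = 0) n = 0" using ex by (rule LeastI_ex)
    then show "evaluates p [LEAST k. g k n = 0, n] 0" using g_eval by metis
  next
    fix m assume "m < (LEAST k. g k n = 0)"
    then have "g m n > 0" using not_less_Least by blast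
    then show "\<exists>y>0. evaluates p [m, n] y" using g_eval by blast
  qed
  then show ?thesis unfolding computable_def by blast
qed

section \<open>A slowly growing level function\<close>

text \<open>
  The increments \<open>2 * (f k + 1) + 1\<close> are the sizes of the Folner sets with index \<open>f k + 1\<close>, the first
  index beyond \<open>f k\<close>. They are summed so that the threshold increases even where \<open>f\<close> decreases.
\<close>

primrec threshold :: "(nat \<Rightarrow> nat) \<Rightarrow> nat \<Rightarrow> nat" where
  "threshold f 0 = 0"
| "threshold f (Suc k) = threshold f k + (2 * f (Suc k) + 3)"

definition level :: "(nat \<Rightarrow> nat) \<Rightarrow> nat \<Rightarrow> nat" where
  "level f n = (LEAST k. n \<le> threshold f k)"

lemma threshold_ge: "k \<le> threshold f k"
  by (induction k) auto

lemma threshold_mono: "k \<le> l \<Longrightarrow> threshold f k \<le> threshold f l"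
  by (rule lift_Suc_mono_le[of "threshold f"]) auto

text \<open>
  The level and the threshold form a Galois connection, from which monotonicity, positivity and the
  bounds on the level are read off.
\<close>

lemma level_le_iff: "level f n \<le> k \<longleftrightarrow> n \<le> threshold f k"
proof
  assume "level f n \<le> k"
  moreover have "n \<le> threshold f (level f n)"
    unfolding level_def by (rule LeastI) (rule threshold_ge)
  ultimately show "n \<le> threshold f k"
    using threshold_mono le_trans by blast
qed (simp add: level_def Least_le)

lemma level_mono: "m \<le> n \<Longrightarrow> level f m \<le> level f n"
  using level_le_iff le_trans by blast

lemma level_pos: "level f (Suc n) > 0"
  using level_le_iff[of f "Suc n" 0] by simp

lemma level_folner_length_le: "k > 0 \<Longrightarrow> level f (2 * Suc (f k) + 1) \<le> k"
  by (cases k) (auto simp: level_le_iff)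

lemma computable_level:
  assumes "computable f"
  shows "computable (level f)"
proof -
  have f: "total_rec a (\<lambda>xs. f (g xs))" if "total_rec a g" for a g
    using assms that by (simp add: computable_iff_total_rec total_rec_comp1)
  let ?step = "\<lambda>zs. zs ! 1 + Suc (Suc (Suc (f (Suc (zs ! 0)) + f (Suc (zs ! 0)))))"
  have "total_rec 2 ?step"
    by (intro total_rec_add total_rec_Suc f total_rec_proj) auto
  then have "computable (threshold f)"
    by (rule computable_primrec) auto
  then have "total_rec 2 (\<lambda>zs. threshold f (zs ! 0))"
    unfolding computable_iff_total_rec by (rule total_rec_comp1) (auto intro: total_rec_proj)
  then have "total_rec 2 (\<lambda>zs. zs ! 1 - threshold f (zs ! 0))"
    by (intro total_rec_diff total_rec_proj) auto
  then have "computable (\<lambda>n. LEAST k. n - threshold f k = 0)"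
    by (rule computable_Least) (use threshold_ge in auto)
  then show ?thesis by (simp add: level_def[abs_def])
qed

section \<open>The greedy sequence\<close>

text \<open>
  \<open>ones f n\<close> is the number of ones among the first \<open>n\<close> terms. The next term is
  \<open>1 - (level f (Suc n) * ones f n - n)\<close> in truncated arithmetic: it is \<open>1\<close> if
  \<open>level f (Suc n) * ones f n \<le> n\<close>, that is, if without it the average of the first \<open>Suc n\<close> terms
  would be below \<open>1 / level f (Suc n)\<close>, and \<open>0\<close> otherwise.
\<close>

primrec ones :: "(nat \<Rightarrow> nat) \<Rightarrow> nat \<Rightarrow> nat" where
  "ones f 0 = 0"
| "ones f (Suc n) = ones f n + (1 - (level f (Suc n) * ones f n - n))"

definition greedy :: "(nat \<Rightarrow> nat) \<Rightarrow> nat \<Rightarrow> nat" where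
  "greedy f n = 1 - (level f (Suc n) * ones f n - n)"

lemma ones_eq_sum: "ones f n = (\<Sum>m<n. greedy f m)"
  by (induction n) (auto simp: greedy_def)

lemma computable_greedy:
  assumes "computable f"
  shows "computable (greedy f)"
proof -
  have level: "total_rec a (\<lambda>xs. level f (g xs))" if "total_rec a g" for a g
    using computable_level[OF assms] that by (simp add: computable_iff_total_rec total_rec_comp1)
  let ?term = "\<lambda>zs. Suc 0 - (level f (Suc (zs ! 0)) * zs ! 1 - zs ! 0)"
  have term_rec: "total_rec 2 ?term"
    by (intro total_rec_diff total_rec_mult level total_rec_Suc total_rec_zero total_rec_proj) auto
  then have "total_rec 2 (\<lambda>zs. zs ! 1 + ?term zs)"
    by (intro total_rec_add total_rec_proj) auto
  then have "computable (ones f)"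
    by (rule computable_primrec) auto
  then have "total_rec 1 (\<lambda>xs. ?term [xs ! 0, ones f (xs ! 0)])"
    unfolding computable_iff_total_rec
    using total_rec_comp2[where u = "\<lambda>m n. ?term [m, n]" and a = 1 and g = "\<lambda>xs. xs ! 0"
        and h = "\<lambda>xs. ones f (xs ! 0)"] term_rec
    by (simp add: total_rec_proj)
  then show ?thesis by (simp add: computable_iff_total_rec greedy_def)
qed

text \<open>
  If \<open>n \<le> level f n * ones f n\<close>, then, as the level does not decrease, the inequality for \<open>Suc n\<close>
  can fail by at most one before the next term is chosen. In that case a \<open>1\<close> is placed, which adds
  \<open>level f (Suc n) \<ge> 1\<close> to the right-hand side.
\<close>

lemma ones_ge: "n \<le> level f n * ones f n"
proof (induction n)
  case (Suc n)
  let ?l = "level f (Suc n)" and ?s = "ones f n"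
  have IH: "n \<le> ?l * ?s"
    using Suc by (rule le_trans) (simp add: level_mono mult_le_mono1 del: ones.simps)
  show ?case
  proof (cases "?l * ?s \<le> n")
    case True
    then have "?l * ones f (Suc n) = ?l * ?s + ?l" by simp
    with IH level_pos[of f n] show ?thesis by linarith
  next
    case False
    then have "ones f (Suc n) = ?s" by simp
    with False show ?thesis by simp
  qed
qed simp

text \<open>
  Up to \<open>threshold f K\<close> the trivial bound \<open>ones f n \<le> n\<close> is used. Later the level exceeds \<open>K\<close>, so
  a \<open>1\<close> is only placed while \<open>K * ones f n \<le> n\<close>.
\<close>

lemma ones_le: "K * ones f n \<le> n + K * Suc (threshold f K)"
proof (induction n)
  case (Suc n)
  have trivial_bound: "ones f m \<le> m" for m
    by (induction m) (simp_all add: le_SucI add_le_mono1 trans_le_add1)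
  consider (early) "Suc n \<le> threshold f K" | (zero) "n < level f (Suc n) * ones f n"
    | (one) "threshold f K < Suc n" "level f (Suc n) * ones f n \<le> n"
    by arith
  then show ?case
  proof cases
    case early
    with trivial_bound[of "Suc n"] have "ones f (Suc n) \<le> Suc (threshold f K)" by linarith
    then have "K * ones f (Suc n) \<le> K * Suc (threshold f K)" by (rule mult_le_mono2)
    then show ?thesis by linarith
  next
    case zero
    with Suc show ?thesis by simp
  next
    case one
    then have "K \<le> level f (Suc n)"
      using level_le_iff[of f "Suc n" K] by linarith
    then have "K * ones f n \<le> n"
      using one(2) by (meson mult_le_mono1 le_trans)
    then show ?thesis using one(2) by simp
  qed
qed simp

lemma greedy_average_tendsto_0: "(\<lambda>n. real (ones f n) / real n) \<longlonglongrightarrow> 0"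
proof (rule LIMSEQ_I)
  fix e :: real assume "e > 0"
  then obtain K where K: "K > 0" "1 / real K < e / 2"
    using real_arch_inverse[of "e / 2"] by (auto simp: inverse_eq_divide)
  define c where "c = real (Suc (threshold f K))"
  obtain N where N: "c / (e / 2) < real N"
    using reals_Archimedean2 by blast
  have "norm (real (ones f n) / real n - 0) < e" if n: "n \<ge> Suc N" for n
  proof -
    have "real K * real (ones f n) \<le> real n + real K * c"
      using ones_le[of K f n] unfolding c_def by (metis of_nat_add of_nat_le_iff of_nat_mult)
    then have "real (ones f n) / real n \<le> 1 / real K + c / real n"
      using K n by (simp add: field_simps)
    moreover have "c / real n < e / 2"
    proof -
      have "c / (e / 2) < real n" using N n by linarith
      then show ?thesis using \<open>e > 0\<close> n by (simp add: field_simps)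
    qed
    ultimately have "real (ones f n) / real n < e" using K by linarith
    then show ?thesis by simp
  qed
  then show "\<exists>no. \<forall>n\<ge>no. norm (real (ones f n) / real n - 0) < e" by blast
qed

section \<open>Means along the enumeration of the integers\<close>

lemma sum_symmetric_interval_eq_sum_int_decode:
  fixes x :: "int \<Rightarrow> 'a :: comm_monoid_add"
  shows "(\<Sum>h = - int j..int j. x h) = (\<Sum>m<2 * j + 1. x (int_decode m))"
proof (induction j)
  case 0
  then show ?case by (simp add: int_decode_def sum_decode_def)
next
  case (Suc j)
  have "{- int (Suc j)..int (Suc j)} = insert (int (Suc j)) (insert (- int (Suc j)) {- int j..int j})"
    by auto
  moreover have "int_decode (Suc (2 * j)) = - int (Suc j)" "int_decode (2 * Suc j) = int (Suc j)"
    by (simp_all add: int_decode_def sum_decode_def)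
  ultimately show ?case
    using Suc by (simp add: add_ac)
qed

lemma folner_mean_greedy:
  "folner_mean j (\<lambda>h. greedy f (int_encode h)) = real (ones f (2 * j + 1)) / real (2 * j + 1)"
  unfolding folner_mean_def sum_symmetric_interval_eq_sum_int_decode ones_eq_sum
  by simp

theorem theorem3:
  fixes f :: "nat \<Rightarrow> nat"
  assumes "computable f"
  shows "\<exists>x\<^sub>0 :: int \<Rightarrow> nat. range x\<^sub>0 \<subseteq> {0, 1} \<and> computable_int x\<^sub>0
    \<and> (\<lambda>i. folner_mean i x\<^sub>0) \<longlonglongrightarrow> 0
    \<and> (\<forall>k>0. \<exists>j>f k. \<bar>folner_mean j x\<^sub>0\<bar> \<ge> 1 / real k)"
proof (rule exI[of _ "\<lambda>h. greedy f (int_encode h)"], intro conjI allI impI)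
  let ?x = "\<lambda>h. greedy f (int_encode h)"
  show "range ?x \<subseteq> {0, 1}"
    by (auto simp: greedy_def)
  show "computable_int ?x"
    using computable_greedy[OF assms] by (simp add: computable_int_def)
  have "strict_mono (\<lambda>j::nat. 2 * j + 1)"
    by (simp add: strict_mono_def)
  from LIMSEQ_subseq_LIMSEQ[OF greedy_average_tendsto_0 this, of f]
  show "(\<lambda>i. folner_mean i ?x) \<longlonglongrightarrow> 0"
    by (simp only: folner_mean_greedy comp_def)
  fix k :: nat assume k: "k > 0"
  let ?n = "2 * Suc (f k) + 1"
  have "?n \<le> k * ones f ?n"
    by (rule le_trans[OF ones_ge mult_le_mono1[OF level_folner_length_le[OF k]]])
  then have "real ?n \<le> real k * real (ones f ?n)"
    by (metis of_nat_le_iff of_nat_mult)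
  then have "1 / real k \<le> real (ones f ?n) / real ?n"
    using k by (simp add: field_simps)
  then have "1 / real k \<le> \<bar>folner_mean (Suc (f k)) ?x\<bar>"
    unfolding folner_mean_greedy by linarith
  then show "\<exists>j>f k. 1 / real k \<le> \<bar>folner_mean j ?x\<bar>"
    by blast
qed

end
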